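(* Let $d=2$, let $f(x_1,x_2)$ be an entire function of order $\rho=\rho(f)<1$, and consider the strip with locus defined by $(x_1-a)(x_1+a)=0$, where $a>0$. Then there exists an entire harmonic function $h$ of order $\le\rho$ such that $h=f$ on $\Omega:=\{(x_1,x_2)\in\mathbb{R}^2:x_1^2=a^2\}$.
   Context: An entire function is a holomorphic function $f:\mathbb{C}^2\to\mathbb{C}$, also viewed as a function on $\mathbb{R}^2$ by restriction. It is called harmonic if $\Delta h=\partial^2h/\partial x_1^2+\partial^2h/\partial x_2^2=0$. Order: with $\mathbb{S}^1=\{\theta\in\mathbb{R}^2:|\theta|=1\}$ and, for $r>0$, $M(f,r)=\sup\{|f(\zeta\theta)|:\zeta\in\mathbb{C},|\zeta|=r,\theta\in\mathbb{S}^1\}$, the order of a non-constant entire function $f$ is $\rho(f)=\limsup_{r\to\infty}\frac{\log\log M(f,r)}{\log r}\in[0,\infty]$; constant functions are regarded as having order $0$. (The same order results if $M(f,r)$ is replaced by $\sup\{|f(z)|:z\in\mathbb{C}^2,|z|=r\}$.) *)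

theory Defs
  imports "HOL-Complex_Analysis.Complex_Analysis"
begin

text \<open>Holomorphy on the whole of complex 2-space: at every point the real (Frechet) derivative
  exists and is complex linear.\<close>

definition entire2 :: "(complex \<times> complex \<Rightarrow> complex) \<Rightarrow> bool" where
  "entire2 f \<longleftrightarrow>
     (\<forall>z. \<exists>a b. (f has_derivative (\<lambda>v. a * fst v + b * snd v)) (at z))"

definition pderiv1 :: "(complex \<times> complex \<Rightarrow> complex) \<Rightarrow> complex \<times> complex \<Rightarrow> complex" where
  "pderiv1 f z = deriv (\<lambda>u. f (u, snd z)) (fst z)"

definition pderiv2 :: "(complex \<times> complex \<Rightarrow> complex) \<Rightarrow> complex \<times> complex \<Rightarrow> complex" where
  "pderiv2 f z = deriv (\<lambda>u. f (fst z, u)) (snd z)"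

definition laplacian2 :: "(complex \<times> complex \<Rightarrow> complex) \<Rightarrow> complex \<times> complex \<Rightarrow> complex" where
  "laplacian2 f z = pderiv1 (pderiv1 f) z + pderiv2 (pderiv2 f) z"

text \<open>The derivatives are the complex ones, which at real points agree with the real partial
  derivatives of the restriction. For entire functions, vanishing of the Laplacian on the real plane
  and on complex 2-space are the same condition, by the identity theorem. As \<open>deriv\<close> is total,
  this notion is only meaningful together with \<open>entire2\<close>.\<close>

definition harmonic2 :: "(complex \<times> complex \<Rightarrow> complex) \<Rightarrow> bool" where
  "harmonic2 h \<longleftrightarrow> (\<forall>z. laplacian2 h z = 0)"

definition cplx_pair :: "real \<times> real \<Rightarrow> complex \<times> complex" where
  "cplx_pair x = (complex_of_real (fst x), complex_of_real (snd x))"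

text \<open>The norm on \<open>real \<times> real\<close> is the Euclidean one, so \<open>sphere 0 1\<close> is the
  unit circle. The set below is bounded for continuous \<open>f\<close>, so the real supremum is genuine.\<close>

definition max_modulus2 :: "(complex \<times> complex \<Rightarrow> complex) \<Rightarrow> real \<Rightarrow> real" where
  "max_modulus2 f r =
     Sup {cmod (f (\<zeta> * fst (cplx_pair \<theta>), \<zeta> * snd (cplx_pair \<theta>))) | \<zeta> \<theta>.
            cmod \<zeta> = r \<and> \<theta> \<in> sphere 0 1}"

text \<open>For non-constant entire \<open>f\<close> the maximum modulus is unbounded, so the real logarithms
  are eventually applied to positive arguments only.\<close>

definition entire_order :: "(complex \<times> complex \<Rightarrow> complex) \<Rightarrow> ereal" where
  "entire_order f =
     (if f constant_on UNIV then 0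
      else Limsup at_top (\<lambda>r::real. ereal (ln (ln (max_modulus2 f r)) / ln r)))"

end

theory Submission
  imports Defs "HOL-Real_Asymp.Real_Asymp"
begin

text \<open>Harmonic entire functions on complex 2-space are sums \<open>\<phi> (y + i x) + \<psi> (y - i x)\<close>. Writing
  \<open>g\<^sub>+\<close> and \<open>g\<^sub>-\<close> for the restrictions of \<open>f\<close> to \<open>x = a\<close> and \<open>x = - a\<close>, the boundary condition on
  \<open>x = a\<close> determines \<open>\<psi>\<close> from \<open>\<phi>\<close>, and the one on \<open>x = - a\<close> then becomes the difference equation
  \<open>\<phi> (z + 4 i a) - \<phi> z = g\<^sub>+ (z + 3 i a) - g\<^sub>- (z + i a)\<close>.
  The equation \<open>P (z + c) - P z = g z\<close> is solved by inverting \<open>exp (c D) - 1\<close> as a series in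
  \<open>D = d/dz\<close>: with \<open>G\<close> a primitive of \<open>g\<close> and \<open>b\<^sub>n\<close> the coefficients of \<open>t / (exp t - 1)\<close>, put
  \<open>P = (1 / c) \<Sum> b\<^sub>n c\<^sup>n G\<^bsup>(n)\<^esup>\<close>. As \<open>|b\<^sub>n| \<le> 1\<close>, a bound \<open>C exp (|z| powr \<sigma>)\<close> on \<open>G\<close> with
  \<open>\<sigma> < 1\<close> makes the series converge and passes to \<open>P\<close>, by Cauchy's inequality and subadditivity
  of \<open>r powr \<sigma>\<close>.\<close>

text \<open>Writing \<open>u powr s\<close> as \<open>u * u powr (s - 1)\<close>, replacing
  \<open>x + y\<close> by \<open>x\<close> or by \<open>y\<close> in the second factor can only
  enlarge it, since \<open>s - 1 \<le> 0\<close>.\<close>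

lemma powr_add_le:
  fixes x y s :: real
  assumes "0 \<le> x" "0 \<le> y" "0 < s" "s \<le> 1"
  shows "(x + y) powr s \<le> x powr s + y powr s"
proof (cases "x = 0 \<or> y = 0")
  case False
  then have pos: "x > 0" "y > 0" using assms by auto
  have eq: "u powr s = u * u powr (s - 1)" if "u > 0" for u :: real
    using that by (simp add: powr_diff)
  have "(x + y) powr s = x * (x + y) powr (s - 1) + y * (x + y) powr (s - 1)"
    using pos by (subst eq) (auto simp: algebra_simps)
  also have "\<dots> \<le> x * x powr (s - 1) + y * y powr (s - 1)"
    using pos assms by (intro add_mono mult_left_mono powr_mono2') auto
  also have "\<dots> = x powr s + y powr s" using pos by (simp add: eq)
  finally show ?thesis .
qed (use assms in auto)

section \<open>Coefficients of \<open>t / (exp t - 1)\<close>\<close>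

unbundle no vec_syntax

text \<open>The series of \<open>(exp t - 1) / t\<close>. After division by \<open>t\<close> the
  constant term is 1, so the series is invertible.\<close>

definition expm1_series :: "complex fps" where
  "expm1_series = Abs_fps (\<lambda>m. 1 / fact (Suc m))"

text \<open>The exponential generating function of the Bernoulli numbers: coefficient
  \<open>n\<close> is \<open>B_n / n!\<close>, with \<open>B_1 = -1/2\<close>.\<close>

definition bernoulli_series :: "complex fps" where
  "bernoulli_series = inverse expm1_series"

lemma expm1_series_nth: "expm1_series $ m = 1 / fact (Suc m)"
  by (simp add: expm1_series_def)

lemma norm_expm1_series_le: "norm (expm1_series $ m) \<le> (1/2) ^ m"
proof -
  have "(2::real) ^ m \<le> fact (Suc m)"
  proof (induction m)
    case (Suc m)
    have "(2::real) * 2 ^ m \<le> real (Suc (Suc m)) * fact (Suc m)"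
      by (intro mult_mono Suc) auto
    then show ?case by simp
  qed simp
  then have "1 / fact (Suc m) \<le> (1 / 2 ^ m :: real)" by (intro divide_left_mono) auto
  then show ?thesis by (simp add: expm1_series_nth norm_divide power_one_over del: fact_Suc)
qed

lemma bernoulli_convolution:
  "(\<Sum>i\<le>n. bernoulli_series $ i * expm1_series $ (n - i)) = (if n = 0 then 1 else 0)"
proof -
  have "bernoulli_series * expm1_series = 1"
    unfolding bernoulli_series_def by (rule inverse_mult_eq_1) (simp add: expm1_series_nth)
  then have "(bernoulli_series * expm1_series) $ n = (1 :: complex fps) $ n" by simp
  then show ?thesis by (simp only: fps_mult_nth atLeast0AtMost fps_one_nth)
qed

text \<open>Solving the convolution identity for its last term expresses coefficient
  \<open>n > 0\<close> through the earlier ones, with weights at most \<open>(1/2) ^ (n - i)\<close>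
  in modulus; these bounds sum to less than 1.\<close>

lemma norm_bernoulli_le_1: "norm (bernoulli_series $ n) \<le> 1"
proof (induction n rule: less_induct)
  case (less n)
  show ?case
  proof (cases "n = 0")
    case True
    then show ?thesis using bernoulli_convolution[of 0] by (simp add: expm1_series_nth)
  next
    case False
    have "(\<Sum>i<n. bernoulli_series $ i * expm1_series $ (n - i)) + bernoulli_series $ n = 0"
      using bernoulli_convolution[of n] False
      by (simp add: expm1_series_nth lessThan_Suc_atMost[symmetric])
    then have "norm (bernoulli_series $ n) = norm (\<Sum>i<n. bernoulli_series $ i * expm1_series $ (n - i))"
      by (metis add_eq_0_iff norm_minus_cancel)
    also have "\<dots> \<le> (\<Sum>i<n. 1 * (1/2) ^ (n - i))"
      unfolding norm_mult
      by (intro order.trans[OF norm_sum] sum_mono)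
         (auto simp only: norm_mult lessThan_iff intro!: mult_mono less norm_expm1_series_le
            norm_ge_zero zero_le_one)
    also have "\<dots> = (\<Sum>m<n. (1/2) ^ Suc m)"
      by (intro sum.reindex_bij_witness[of _ "\<lambda>m. n - Suc m" "\<lambda>m. n - Suc m"])
         (auto simp: Suc_diff_Suc simp del: power_Suc)
    also have "\<dots> = 1 - (1/2) ^ n"
      by (induction n) (auto simp: field_simps)
    also have "\<dots> \<le> (1::real)" by simp
    finally show ?thesis .
  qed
qed

text \<open>The formal identity \<open>bernoulli_series * expm1_series = 1\<close> acting on a
  sequence; later \<open>u n\<close> is \<open>c ^ n\<close> times the n-th derivative of the
  right-hand side at a point. Geometric decay of \<open>u\<close> makes the double series absolutely
  summable, which permits rearrangement.\<close>

lemma bernoulli_expm1_double_series: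
  fixes u :: "nat \<Rightarrow> complex"
  assumes u: "\<And>n. norm (u n) \<le> A * (1/2) ^ n"
  shows "(\<lambda>i. bernoulli_series $ i * (\<Sum>m. expm1_series $ m * u (i + m))) sums u 0"
proof -
  define a where "a = (\<lambda>i m. bernoulli_series $ i * expm1_series $ m * u (i + m))"
  have A: "A \<ge> 0" using order.trans[OF norm_ge_zero u[of 0]] by simp
  have a_le: "norm (a i m) \<le> A * (1/2) ^ i * (1/2) ^ m" for i m
  proof -
    have "norm (a i m) \<le> 1 * 1 * (A * (1/2) ^ (i + m))"
      unfolding a_def norm_mult
      by (intro mult_mono norm_bernoulli_le_1 u order.trans[OF norm_expm1_series_le])
         (auto simp: power_le_one A)
    then show ?thesis by (simp add: power_add mult_ac)
  qed
  have geo: "((\<lambda>m. (1/2::real) ^ m) has_sum 2) UNIV"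
    using geometric_sums[of "1/2::real"] by (intro norm_summable_imp_has_sum) auto
  have dom: "(\<lambda>(i,m). A * (1/2) ^ i * (1/2) ^ m) summable_on UNIV \<times> (UNIV::nat set)"
  proof (rule summable_on_SigmaI[where g = "\<lambda>i. A * (1/2) ^ i * 2"])
    show "((\<lambda>m. case (i, m) of (i, m) \<Rightarrow> A * (1/2) ^ i * (1/2) ^ m) has_sum A * (1/2) ^ i * 2) UNIV"
      for i :: nat
      using has_sum_cmult_right[OF geo, of "A * (1/2) ^ i"] by simp
    show "(\<lambda>i. A * (1/2) ^ i * 2) summable_on (UNIV :: nat set)"
      by (rule summable_on_cmult_left[OF summable_on_cmult_right[OF has_sum_imp_summable[OF geo]]])
  qed (use A in auto)
  have "(\<lambda>(i,m). a i m) summable_on UNIV \<times> UNIV"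
    by (rule abs_summable_summable, rule Infinite_Sum.abs_summable_on_comparison_test'[OF dom])
       (use a_le in auto)
  then obtain S where S: "((\<lambda>(i,m). a i m) has_sum S) (UNIV \<times> UNIV)"
    by (auto simp: summable_on_def)
  have rows: "(\<lambda>m. expm1_series $ m * u (i + m)) sums (\<Sum>m. expm1_series $ m * u (i + m))"
    and arows: "(a i has_sum bernoulli_series $ i * (\<Sum>m. expm1_series $ m * u (i + m))) UNIV" for i
  proof -
    have "norm (expm1_series $ m * u (i + m)) \<le> A * (1/2) ^ m" for m
    proof -
      have "norm (expm1_series $ m * u (i + m)) \<le> 1 * (A * (1/2) ^ (i + m))"
        unfolding norm_mult by (intro mult_mono u order.trans[OF norm_expm1_series_le])
           (auto simp: power_le_one A)
      also have "\<dots> \<le> A * (1/2) ^ m"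
        using A by (auto simp: power_add power_le_one intro!: mult_left_mono mult_left_le_one_le)
      finally show ?thesis .
    qed
    then have sm: "summable (\<lambda>m. norm (expm1_series $ m * u (i + m)))"
      by (intro summable_comparison_test'[OF summable_mult[OF summable_geometric]]) auto
    show rows: "(\<lambda>m. expm1_series $ m * u (i + m)) sums (\<Sum>m. expm1_series $ m * u (i + m))"
      by (rule summable_sums[OF summable_norm_cancel[OF sm]])
    have "((\<lambda>m. expm1_series $ m * u (i + m)) has_sum (\<Sum>m. expm1_series $ m * u (i + m))) UNIV"
      by (rule norm_summable_imp_has_sum[OF sm rows])
    then show "(a i has_sum bernoulli_series $ i * (\<Sum>m. expm1_series $ m * u (i + m))) UNIV"
      unfolding a_def mult.assoc by (rule has_sum_cmult_right)
  qed
  have "((\<lambda>i. bernoulli_series $ i * (\<Sum>m. expm1_series $ m * u (i + m))) has_sum S) UNIV"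
    by (rule has_sum_SigmaD[OF S]) (use arows in auto)
  moreover have "S = u 0"
  proof -
    \<comment> \<open>Regroup along the diagonals \<open>n = i + m\<close>. There \<open>u n\<close>
      is a common factor, and the convolution identity kills every diagonal except
      \<open>n = 0\<close>.\<close>
    have "((\<lambda>(n,i). a i (n - i)) has_sum S) (SIGMA n:UNIV. {..n})"
      by (rule has_sum_reindex_bij_witness[of _ "\<lambda>(i,m). (i + m, i)" "\<lambda>(n,i). (i, n - i)",
            THEN iffD2, OF _ _ _ _ _ _ S]) auto
    then have "((\<lambda>n. \<Sum>i\<le>n. a i (n - i)) has_sum S) UNIV"
      by (rule has_sum_SigmaD) (auto intro!: has_sum_finite)
    moreover have "(\<Sum>i\<le>n. a i (n - i)) = (if n = 0 then u 0 else 0)" for n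
    proof -
      have "(\<Sum>i\<le>n. a i (n - i)) = (\<Sum>i\<le>n. bernoulli_series $ i * expm1_series $ (n - i)) * u n"
        unfolding a_def sum_distrib_right by (intro sum.cong) auto
      then show ?thesis by (simp only: bernoulli_convolution) simp
    qed
    ultimately have "((\<lambda>n. if n = 0 then u 0 else 0) has_sum S) (UNIV :: nat set)" by simp
    then have "(\<lambda>n::nat. if n = 0 then u 0 else 0) sums S" by (rule has_sum_imp_sums)
    moreover have "(\<lambda>n::nat. if n = 0 then u 0 else 0) sums u 0" by (rule sums_single)
    ultimately show ?thesis by (rule sums_unique2)
  qed
  ultimately show ?thesis by (auto intro: has_sum_imp_sums)
qed

section \<open>Growth of entire functions of one variable\<close>

text \<open>Order at most \<open>\<rho>\<close>, in a form valid for all \<open>z\<close>: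
  \<open>C\<close> absorbs the small \<open>z\<close>, and the strict
  \<open>\<rho> < \<sigma>\<close> leaves the room that a limsup needs. The cap
  \<open>\<sigma> < 1\<close> keeps to exponents with subadditive powers.\<close>

definition order_type_le :: "real \<Rightarrow> (complex \<Rightarrow> complex) \<Rightarrow> bool" where
  "order_type_le \<rho> g \<longleftrightarrow>
     (\<forall>\<sigma>. \<rho> < \<sigma> \<longrightarrow> \<sigma> < 1 \<longrightarrow> (\<exists>C. \<forall>z. cmod (g z) \<le> C * exp (cmod z powr \<sigma>)))"

lemma order_type_leE:
  assumes "order_type_le \<rho> g" "\<rho> < \<sigma>" "\<sigma> < 1"
  obtains C where "C > 0" "\<And>z. cmod (g z) \<le> C * exp (cmod z powr \<sigma>)"
proof -
  obtain C where C: "\<And>z. cmod (g z) \<le> C * exp (cmod z powr \<sigma>)"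
    using assms unfolding order_type_le_def by blast
  have "cmod (g z) \<le> (\<bar>C\<bar> + 1) * exp (cmod z powr \<sigma>)" for z
    by (rule order.trans[OF C]) (simp add: mult_right_mono)
  then show thesis by (intro that[of "\<bar>C\<bar> + 1"]) auto
qed

lemma order_type_le_diff:
  assumes "order_type_le \<rho> f" "order_type_le \<rho> g"
  shows "order_type_le \<rho> (\<lambda>z. f z - g z)"
  unfolding order_type_le_def
proof (intro allI impI)
  fix \<sigma> assume s: "\<rho> < \<sigma>" "\<sigma> < 1"
  obtain C D where "\<And>z. cmod (f z) \<le> C * exp (cmod z powr \<sigma>)"
    "\<And>z. cmod (g z) \<le> D * exp (cmod z powr \<sigma>)"
    using order_type_leE[OF assms(1) s] order_type_leE[OF assms(2) s] by metis
  then have "cmod (f z - g z) \<le> (C + D) * exp (cmod z powr \<sigma>)" for z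
    unfolding distrib_right by (intro order.trans[OF norm_triangle_ineq4] add_mono) auto
  then show "\<exists>C. \<forall>z. cmod (f z - g z) \<le> C * exp (cmod z powr \<sigma>)" by blast
qed

text \<open>A translation thus costs a constant factor and no increase of the exponent.\<close>

lemma exp_cmod_powr_add_le:
  assumes "0 < \<sigma>" "\<sigma> < 1"
  shows "exp (cmod (z + w) powr \<sigma>) \<le> exp (cmod z powr \<sigma>) * exp (cmod w powr \<sigma>)"
proof -
  have "cmod (z + w) powr \<sigma> \<le> (cmod z + cmod w) powr \<sigma>"
    using assms by (intro powr_mono2 norm_triangle_ineq) auto
  also have "\<dots> \<le> cmod z powr \<sigma> + cmod w powr \<sigma>"
    using assms by (intro powr_add_le) auto
  finally show ?thesis by (simp flip: exp_add)
qed

lemma order_type_le_shift: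
  assumes "order_type_le \<rho> g" "0 \<le> \<rho>"
  shows "order_type_le \<rho> (\<lambda>z. g (z + w))"
  unfolding order_type_le_def
proof (intro allI impI)
  fix \<sigma> assume s: "\<rho> < \<sigma>" "\<sigma> < 1"
  obtain C where C: "C > 0" "\<And>z. cmod (g z) \<le> C * exp (cmod z powr \<sigma>)"
    using order_type_leE[OF assms(1) s] by metis
  have "cmod (g (z + w)) \<le> (C * exp (cmod w powr \<sigma>)) * exp (cmod z powr \<sigma>)" for z
  proof -
    have "cmod (g (z + w)) \<le> C * (exp (cmod z powr \<sigma>) * exp (cmod w powr \<sigma>))"
      by (rule order.trans[OF C(2)])
         (use C(1) s assms(2) exp_cmod_powr_add_le in \<open>auto intro!: mult_left_mono\<close>)
    then show ?thesis by (simp add: mult_ac)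
  qed
  then show "\<exists>C. \<forall>z. cmod (g (z + w)) \<le> C * exp (cmod z powr \<sigma>)" by blast
qed

text \<open>By the mean value inequality on the disc of radius \<open>cmod z\<close>, integration
  costs a factor \<open>cmod z\<close>. It is absorbed by starting from an exponent strictly between
  \<open>\<rho>\<close> and \<open>\<sigma>\<close>.\<close>

lemma order_type_le_primitive:
  assumes der: "\<And>z. (G has_field_derivative g z) (at z)"
    and g: "order_type_le \<rho> g" and "0 \<le> \<rho>"
  shows "order_type_le \<rho> G"
  unfolding order_type_le_def
proof (intro allI impI)
  fix \<sigma> assume s: "\<rho> < \<sigma>" "\<sigma> < 1"
  define \<tau> where "\<tau> = (\<rho> + \<sigma>) / 2"
  have t: "\<rho> < \<tau>" "\<tau> < \<sigma>" "\<tau> < 1" "0 < \<tau>" using s assms(3) by (auto simp: \<tau>_def)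
  obtain C where C: "C > 0" "\<And>z. cmod (g z) \<le> C * exp (cmod z powr \<tau>)"
    using order_type_leE[OF g t(1,3)] by metis
  have "eventually (\<lambda>r::real. r * exp (r powr \<tau>) \<le> exp (r powr \<sigma>)) at_top"
    using t by real_asymp
  then obtain R where R: "\<And>r. r \<ge> R \<Longrightarrow> r * exp (r powr \<tau>) \<le> exp (r powr \<sigma>)"
    unfolding eventually_at_top_linorder by blast
  \<comment> \<open>The summand 1 serves radii from \<open>R\<close> on; below \<open>R\<close>,
    monotonicity bounds the left side by its value at \<open>\<bar>R\<bar>\<close>.\<close>
  define D where "D = 1 + \<bar>R\<bar> * exp (\<bar>R\<bar> powr \<tau>)"
  have D: "r * exp (r powr \<tau>) \<le> D * exp (r powr \<sigma>)" if "r \<ge> 0" for r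
  proof (cases "r \<ge> R")
    case True
    have "1 * exp (r powr \<sigma>) \<le> D * exp (r powr \<sigma>)" by (intro mult_right_mono) (auto simp: D_def)
    then show ?thesis using R[OF True] by linarith
  next
    case False
    then have "r * exp (r powr \<tau>) \<le> \<bar>R\<bar> * exp (\<bar>R\<bar> powr \<tau>)"
      using that t by (intro mult_mono) (auto intro!: powr_mono2)
    also have "\<dots> \<le> D * 1" by (simp add: D_def)
    also have "\<dots> \<le> D * exp (r powr \<sigma>)" by (intro mult_left_mono) (auto simp: D_def)
    finally show ?thesis .
  qed
  have "cmod (G z) \<le> (cmod (G 0) + C * D) * exp (cmod z powr \<sigma>)" for z
  proof -
    have "cmod (G z - G 0) \<le> (C * exp (cmod z powr \<tau>)) * cmod (z - 0)"
    proof (rule field_differentiable_bound[where S = "cball 0 (cmod z)" and f' = g])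
      fix w :: complex assume "w \<in> cball 0 (cmod z)"
      then have "C * exp (cmod w powr \<tau>) \<le> C * exp (cmod z powr \<tau>)"
        using C(1) t by (auto intro!: powr_mono2)
      then show "cmod (g w) \<le> C * exp (cmod z powr \<tau>)" using C(2)[of w] by linarith
    qed (auto intro: has_field_derivative_at_within der)
    then have "cmod (G z - G 0) \<le> C * (cmod z * exp (cmod z powr \<tau>))" by (simp add: mult_ac)
    also have "\<dots> \<le> C * (D * exp (cmod z powr \<sigma>))"
      using C(1) by (intro mult_left_mono D) auto
    finally have "cmod (G z) \<le> cmod (G 0) * 1 + C * (D * exp (cmod z powr \<sigma>))"
      using norm_triangle_sub[of "G z" "G 0"] by simp
    also have "\<dots> \<le> cmod (G 0) * exp (cmod z powr \<sigma>) + C * (D * exp (cmod z powr \<sigma>))"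
      by (rule add_mono[OF mult_left_mono order_refl]) auto
    finally show ?thesis by (simp add: algebra_simps)
  qed
  then show "\<exists>C. \<forall>z. cmod (G z) \<le> C * exp (cmod z powr \<sigma>)" by blast
qed

section \<open>Derivative bounds and the difference equation\<close>

lemma exp_powr_le_power2:
  fixes K \<sigma> :: real
  assumes "K > 0" "0 < \<sigma>" "\<sigma> < 1"
  obtains D where "D > 0" "\<And>n::nat. exp ((K * real n) powr \<sigma>) \<le> D * 2 ^ n"
proof -
  have "(\<lambda>n::nat. exp ((K * real n) powr \<sigma>) / 2 ^ n) \<longlonglongrightarrow> 0"
    using assms by real_asymp
  then have "Bseq (\<lambda>n. exp ((K * real n) powr \<sigma>) / 2 ^ n)"
    by (intro convergent_imp_Bseq convergentI)
  then obtain D where D: "D > 0" "\<And>n. norm (exp ((K * real n) powr \<sigma>) / 2 ^ n) \<le> D"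
    by (auto elim: BseqE)
  show thesis
    by (rule that[OF D(1)]) (use D(2) in \<open>simp add: field_simps\<close>)
qed

text \<open>Cauchy's inequality on a circle about \<open>z\<close> of radius proportional to \<open>n\<close>: as \<open>n! \<le> n ^ n\<close> and
  \<open>exp (n powr \<sigma>)\<close> is subexponential for \<open>\<sigma> < 1\<close>, the factor \<open>(1/2) ^ n\<close> survives. This is where
  order below \<open>1\<close> is essential.\<close>

lemma norm_higher_deriv_le:
  assumes hol: "g holomorphic_on UNIV" and g: "order_type_le \<rho> g"
    and "0 \<le> \<rho>" "\<rho> < \<sigma>" "\<sigma> < 1"
  obtains A where "A > 0"
    "\<And>n z. cmod (c ^ n * (deriv ^^ n) g z) \<le> A * exp (cmod z powr \<sigma>) * (1/2) ^ n"
proof -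
  obtain C where C: "C > 0" "\<And>z. cmod (g z) \<le> C * exp (cmod z powr \<sigma>)"
    using order_type_leE[OF g assms(4,5)] by metis
  \<comment> \<open>The final ratio is \<open>2 * cmod c / K\<close>, its 2 coming from
    \<open>D * 2 ^ n\<close>; the 4 brings it down to 1/2, and the added 1 keeps the radius positive
    even for \<open>c = 0\<close>.\<close>
  define K where "K = 4 * cmod c + 1"
  have K: "K > 0" "4 * cmod c \<le> K" unfolding K_def by (auto simp: add_nonneg_pos)
  obtain D where D: "D > 0" "\<And>n. exp ((K * real n) powr \<sigma>) \<le> D * 2 ^ n"
    using exp_powr_le_power2[of K \<sigma>] K assms by auto
  have bound: "cmod ((deriv ^^ n) g z) \<le> C * exp (cmod z powr \<sigma>) * (D * 2 ^ n) / K ^ n" for n z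
  proof -
    define B where "B = C * exp (cmod z powr \<sigma>) * exp ((K * real n) powr \<sigma>)"
    have "cmod ((deriv ^^ n) g z) \<le> B / K ^ n"
    \<comment> \<open>For \<open>n = 0\<close> the circle degenerates to a point, and the growth
      bound at \<open>z\<close> itself is the claim.\<close>
    proof (cases "n = 0")
      case True
      then show ?thesis using C(2)[of z] by (simp add: B_def)
    next
      case False
      have "cmod ((deriv ^^ n) g z) \<le> fact n * B / (K * n) ^ n"
      proof (rule Cauchy_inequality)
        fix x assume x: "cmod (z - x) = K * real n"
        have "exp (cmod (z + (x - z)) powr \<sigma>) \<le> exp (cmod z powr \<sigma>) * exp (cmod (x - z) powr \<sigma>)"
          using assms by (intro exp_cmod_powr_add_le) auto
        then have "C * exp (cmod x powr \<sigma>) \<le> B"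
          using C(1) x by (simp add: B_def norm_minus_commute mult.assoc)
        then show "cmod (g x) \<le> B" using C(2)[of x] by linarith
      next
        show "g holomorphic_on ball z (K * real n)" by (rule holomorphic_on_subset[OF hol]) simp
        show "continuous_on (cball z (K * real n)) g"
          by (rule continuous_on_subset[OF holomorphic_on_imp_continuous_on[OF hol]]) simp
      qed (use K False in simp)
      also have "\<dots> \<le> real n ^ n * B / (K * n) ^ n"
      proof -
        have "(fact n :: real) \<le> of_nat (n ^ n)" by (rule fact_le_power) 
        then have "fact n \<le> real n ^ n" by simp
        moreover have "B \<ge> 0" using C by (simp add: B_def)
        ultimately show ?thesis using K by (intro divide_right_mono mult_right_mono) auto
      qed
      also have "\<dots> = B / K ^ n" using False by (simp add: power_mult_distrib)
      finally show ?thesis .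
    qed
    also have "\<dots> \<le> C * exp (cmod z powr \<sigma>) * (D * 2 ^ n) / K ^ n"
      unfolding B_def using C D K by (intro divide_right_mono mult_left_mono) auto
    finally show ?thesis .
  qed
  show thesis
  proof (rule that[of "C * D"])
    fix n z
    have "cmod (c ^ n * (deriv ^^ n) g z)
        \<le> cmod c ^ n * (C * exp (cmod z powr \<sigma>) * (D * 2 ^ n) / K ^ n)"
      unfolding norm_mult norm_power by (intro mult_left_mono bound) auto
    also have "\<dots> = C * D * exp (cmod z powr \<sigma>) * (2 * cmod c / K) ^ n"
      by (simp add: power_mult_distrib power_divide)
    also have "\<dots> \<le> C * D * exp (cmod z powr \<sigma>) * (1/2) ^ n"
      using C D K by (intro mult_left_mono power_mono) (auto simp: field_simps)
    finally show "cmod (c ^ n * (deriv ^^ n) g z) \<le> C * D * exp (cmod z powr \<sigma>) * (1/2) ^ n" .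
  qed (use C D in auto)
qed

text \<open>As a power series in \<open>D\<close>, \<open>exp (c D) - 1\<close> has zero constant
  term and no inverse; passing to a primitive first supplies the missing factor
  \<open>1 / D\<close>.\<close>

lemma difference_equation:
  assumes hol: "g holomorphic_on UNIV" and g: "order_type_le \<rho> g"
    and \<rho>: "0 \<le> \<rho>" "\<rho> < 1" and c: "c \<noteq> 0"
  obtains P where "P holomorphic_on UNIV" "order_type_le \<rho> P" "\<And>z. P (z + c) - P z = g z"
proof -
  obtain G where G: "\<And>z. (G has_field_derivative g z) (at z)"
    using holomorphic_convex_primitive'[OF convex_UNIV open_UNIV hol] by auto
  have G_hol: "G holomorphic_on UNIV"
    using G by (auto simp: holomorphic_on_open)
  have G_order: "order_type_le \<rho> G"
    by (rule order_type_le_primitive[OF G g \<rho>(1)])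
  have deriv_G: "(deriv ^^ Suc n) G = (deriv ^^ n) g" for n
  proof -
    have "deriv G = g" using G DERIV_imp_deriv by blast
    then show ?thesis by (simp add: funpow_Suc_right del: funpow.simps)
  qed
  define t where "t = (\<lambda>n z. bernoulli_series $ n * (c ^ n * (deriv ^^ n) G z))"
  \<comment> \<open>The terms do not depend on \<open>\<sigma>\<close>: one exponent gives
    convergence, and letting \<open>\<sigma>\<close> vary gives the order of the same sum.\<close>
  have t_le: "\<exists>A>0. \<forall>n z. cmod (t n z) \<le> A * exp (cmod z powr \<sigma>) * (1/2) ^ n"
    if s: "\<rho> < \<sigma>" "\<sigma> < 1" for \<sigma>
  proof -
    obtain A where A: "A > 0"
      "\<And>n z. cmod (c ^ n * (deriv ^^ n) G z) \<le> A * exp (cmod z powr \<sigma>) * (1/2) ^ n"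
      using norm_higher_deriv_le[OF G_hol G_order \<rho>(1) s, of c] by metis
    have "cmod (t n z) \<le> 1 * (A * exp (cmod z powr \<sigma>) * (1/2) ^ n)" for n z
      unfolding t_def norm_mult[of "bernoulli_series $ n"]
      by (intro mult_mono norm_bernoulli_le_1 A) auto
    then show ?thesis using A(1) by auto
  qed
  define \<sigma>0 where "\<sigma>0 = (\<rho> + 1) / 2"
  have s0: "\<rho> < \<sigma>0" "\<sigma>0 < 1" "0 < \<sigma>0" using \<rho> by (auto simp: \<sigma>0_def)
  obtain A where A: "A > 0" "\<And>n z. cmod (t n z) \<le> A * exp (cmod z powr \<sigma>0) * (1/2) ^ n"
    using t_le[OF s0(1,2)] by auto
  have geo: "summable (\<lambda>n. B * (1/2::real) ^ n)" for B
    by (intro summable_mult summable_geometric) auto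
  have t_summable: "summable (\<lambda>n. t n z)" for z
    by (rule summable_comparison_test'[OF geo A(2)])
  define P where "P = (\<lambda>z. (\<Sum>n. t n z) / c)"
  have P_hol: "P holomorphic_on UNIV"
  proof -
    have "(\<lambda>z. \<Sum>n. t n z) holomorphic_on UNIV"
    proof (rule holomorphic_uniform_sequence[where f = "\<lambda>N z. \<Sum>n<N. t n z"])
      fix z :: complex
      have "uniform_limit (cball z 1) (\<lambda>N w. \<Sum>n<N. t n w) (\<lambda>w. \<Sum>n. t n w) sequentially"
      proof (rule Weierstrass_m_test[OF _ geo])
        fix n w assume w: "w \<in> cball z 1"
        have "cmod w \<le> cmod z + 1"
          using w norm_triangle_sub[of w z] by (simp add: dist_norm norm_minus_commute)
        then have "cmod w powr \<sigma>0 \<le> (cmod z + 1) powr \<sigma>0"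
          using s0 by (intro powr_mono2) auto
        then have "A * exp (cmod w powr \<sigma>0) * (1/2) ^ n \<le> A * exp ((cmod z + 1) powr \<sigma>0) * (1/2) ^ n"
          using A(1) by (intro mult_mono) auto
        then show "cmod (t n w) \<le> (A * exp ((cmod z + 1) powr \<sigma>0)) * (1/2) ^ n"
          using A(2)[of n w] by linarith
      qed
      then show "\<exists>d>0. cball z d \<subseteq> UNIV \<and>
          uniform_limit (cball z d) (\<lambda>N w. \<Sum>n<N. t n w) (\<lambda>w. \<Sum>n. t n w) sequentially"
        by (intro exI[of _ 1]) auto
    qed (auto simp: t_def intro!: holomorphic_intros G_hol)
    then show ?thesis unfolding P_def using c by (intro holomorphic_intros) auto
  qed
  have P_order: "order_type_le \<rho> P"
    unfolding order_type_le_def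
  proof (intro allI impI)
    fix \<sigma> assume s: "\<rho> < \<sigma>" "\<sigma> < 1"
    obtain A where A: "A > 0" "\<And>n z. cmod (t n z) \<le> A * exp (cmod z powr \<sigma>) * (1/2) ^ n"
      using t_le[OF s] by auto
    have "cmod (P z) \<le> (2 * A / cmod c) * exp (cmod z powr \<sigma>)" for z
    proof -
      have "cmod (\<Sum>n. t n z) \<le> (\<Sum>n. A * exp (cmod z powr \<sigma>) * (1/2) ^ n)"
        by (rule norm_suminf_le[OF A(2) geo])
      also have "\<dots> = A * exp (cmod z powr \<sigma>) * 2"
        by (simp add: suminf_mult suminf_geometric)
      finally show ?thesis using c by (simp add: P_def norm_divide divide_right_mono mult_ac)
    qed
    then show "\<exists>C. \<forall>z. cmod (P z) \<le> C * exp (cmod z powr \<sigma>)" by blast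
  qed
  have "P (z + c) - P z = g z" for z
  proof -
    define u where "u = (\<lambda>n. c ^ n * (deriv ^^ n) g z)"
    obtain A where A: "A > 0"
      "\<And>n z. cmod (c ^ n * (deriv ^^ n) g z) \<le> A * exp (cmod z powr \<sigma>0) * (1/2) ^ n"
      using norm_higher_deriv_le[OF hol g \<rho>(1) s0(1,2), of c] by metis
    have u: "norm (u n) \<le> (A * exp (cmod z powr \<sigma>0)) * (1/2) ^ n" for n
      unfolding u_def by (rule A(2))
    \<comment> \<open>Taylor expansion of \<open>H\<close> about \<open>z\<close>, evaluated at
      \<open>z + c\<close>. Subtracting \<open>H z\<close> removes the zeroth term; since
      \<open>G\<close> has derivative \<open>g\<close>, the remaining derivatives of
      \<open>H\<close> are those of \<open>g\<close> with index one lower, and one factor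
      \<open>c\<close> comes out in front.\<close>
    have diff: "t i (z + c) - t i z
        = c * (bernoulli_series $ i * (\<Sum>m. expm1_series $ m * u (i + m)))" for i
    proof -
      define H where "H = (deriv ^^ i) G"
      have "H holomorphic_on UNIV" unfolding H_def by (intro holomorphic_intros G_hol) auto
      then have "(\<lambda>n. (deriv ^^ n) H z / fact n * (z + c - z) ^ n) sums H (z + c)"
        by (intro holomorphic_power_series[where r = "cmod c + 1"])
           (auto simp: dist_norm intro: holomorphic_on_subset)
      then have "(\<lambda>n. (deriv ^^ Suc n) H z / fact (Suc n) * c ^ Suc n) sums (H (z + c) - H z)"
        by (intro iffD2[OF sums_Suc_iff[where f = "\<lambda>n. (deriv ^^ n) H z / fact n * c ^ n"]]) simp
      moreover have "(deriv ^^ Suc n) H = (deriv ^^ (i + n)) g" for n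
      proof -
        have "(deriv ^^ Suc n) H = (deriv ^^ Suc (i + n)) G"
          unfolding H_def by (simp only: funpow_add[THEN fun_cong, unfolded comp_def, symmetric])
             (simp add: add.commute)
        then show ?thesis by (simp only: deriv_G)
      qed
      ultimately have "(\<lambda>m. (deriv ^^ (i + m)) g z / fact (Suc m) * c ^ Suc m) sums (H (z + c) - H z)"
        by (simp only:)
      then have "(\<lambda>m. c ^ i * ((deriv ^^ (i + m)) g z / fact (Suc m) * c ^ Suc m) / c)
          sums (c ^ i * (H (z + c) - H z) / c)"
        by (intro sums_divide sums_mult)
      moreover have "c ^ i * ((deriv ^^ (i + m)) g z / fact (Suc m) * c ^ Suc m) / c
          = expm1_series $ m * u (i + m)" for m
        using c by (simp add: expm1_series_nth u_def power_add field_simps del: fact_Suc)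
      ultimately have "(\<lambda>m. expm1_series $ m * u (i + m)) sums (c ^ i * (H (z + c) - H z) / c)"
        by simp
      then have "(\<Sum>m. expm1_series $ m * u (i + m)) = c ^ i * (H (z + c) - H z) / c"
        by (rule sums_unique[symmetric])
      then have "c * (\<Sum>m. expm1_series $ m * u (i + m)) = c ^ i * (H (z + c) - H z)"
        using c by simp
      then show ?thesis
        by (simp add: t_def H_def mult.left_commute[of c "bernoulli_series $ i"] right_diff_distrib)
    qed
    \<comment> \<open>Here \<open>u 0\<close> is \<open>g z\<close>, the only term to survive in the
      double series.\<close>
    have "(\<lambda>i. t i (z + c) - t i z) sums (c * u 0)"
      unfolding diff by (intro sums_mult bernoulli_expm1_double_series[OF u])
    moreover have "(\<lambda>i. t i (z + c) - t i z) sums ((\<Sum>n. t n (z + c)) - (\<Sum>n. t n z))"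
      by (intro sums_diff summable_sums t_summable)
    ultimately have "(\<Sum>n. t n (z + c)) - (\<Sum>n. t n z) = c * g z"
      using sums_unique2 by (fastforce simp: u_def)
    then show ?thesis using c by (simp add: P_def flip: diff_divide_distrib)
  qed
  with P_hol P_order show thesis by (rule that)
qed

section \<open>Entire functions of two variables and their maximum modulus\<close>

lemma entire2_holomorphic_compose:
  assumes "entire2 f" "p holomorphic_on UNIV" "q holomorphic_on UNIV"
  shows "(\<lambda>w. f (p w, q w)) holomorphic_on UNIV"
  unfolding holomorphic_on_open[OF open_UNIV]
proof (intro ballI)
  fix w
  obtain a b where f: "(f has_derivative (\<lambda>v. a * fst v + b * snd v)) (at (p w, q w))"
    using assms(1) unfolding entire2_def by blast
  obtain p' q' where "(p has_field_derivative p') (at w)" "(q has_field_derivative q') (at w)"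
    using assms(2,3) unfolding holomorphic_on_open[OF open_UNIV] by blast
  then have "((\<lambda>w. (p w, q w)) has_derivative (\<lambda>t. (p' * t, q' * t))) (at w)"
    unfolding has_field_derivative_def by (rule has_derivative_Pair)
  from has_derivative_compose[OF this f]
  have "((\<lambda>w. f (p w, q w)) has_field_derivative (a * p' + b * q')) (at w)"
    unfolding has_field_derivative_def
    by (rule has_derivative_eq_rhs) (auto simp: algebra_simps)
  then show "\<exists>f'. ((\<lambda>w. f (p w, q w)) has_field_derivative f') (at w)" by blast
qed

lemma entire2_continuous_on:
  assumes "entire2 f"
  shows "continuous_on S f"
  using assms unfolding entire2_def
  by (meson continuous_at_imp_continuous_on has_derivative_continuous)

text \<open>Liouville's theorem on each complex line through the origin; all these lines share the
  value at the origin.\<close>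

lemma entire2_bounded_imp_constant:
  assumes f: "entire2 f" and B: "\<And>z. cmod (f z) \<le> B"
  shows "f constant_on UNIV"
proof -
  have "f (x, y) = f (0, 0)" for x y
  proof -
    have "(\<lambda>w. f (w * x, w * y)) holomorphic_on UNIV"
      by (rule entire2_holomorphic_compose[OF f]) (auto intro!: holomorphic_intros)
    moreover have "bounded (range (\<lambda>w. f (w * x, w * y)))"
      using B by (auto intro!: boundedI)
    ultimately have "(\<lambda>w. f (w * x, w * y)) constant_on UNIV" by (rule Liouville_theorem)
    then obtain k where "\<And>w. f (w * x, w * y) = k" unfolding constant_on_def by blast
    from this[of 1] this[of 0] show ?thesis by simp
  qed
  then show ?thesis unfolding constant_on_def by (metis surj_pair UNIV_I)
qed

text \<open>The points \<open>\<zeta> \<theta>\<close> have norm \<open>cmod \<zeta>\<close>, so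
  they lie in a compact ball and the supremum is that of a bounded set.\<close>

lemma max_modulus2_ge:
  assumes f: "entire2 f" and "cmod \<zeta> = r" "\<theta> \<in> sphere 0 1"
  shows "cmod (f (\<zeta> * fst (cplx_pair \<theta>), \<zeta> * snd (cplx_pair \<theta>))) \<le> max_modulus2 f r"
  unfolding max_modulus2_def
proof (rule cSup_upper)
  let ?A = "{cmod (f (\<zeta> * fst (cplx_pair \<theta>), \<zeta> * snd (cplx_pair \<theta>))) | \<zeta> \<theta>.
            cmod \<zeta> = r \<and> \<theta> \<in> sphere 0 1}"
  show "cmod (f (\<zeta> * fst (cplx_pair \<theta>), \<zeta> * snd (cplx_pair \<theta>))) \<in> ?A"
    using assms by blast
  have "compact ((\<lambda>z. cmod (f z)) ` cball 0 r)"
    by (intro compact_continuous_image continuous_on_norm entire2_continuous_on f compact_cball)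
  then have "bdd_above ((\<lambda>z. cmod (f z)) ` cball 0 r)"
    by (intro bounded_imp_bdd_above compact_imp_bounded)
  moreover have "?A \<subseteq> (\<lambda>z. cmod (f z)) ` cball 0 r"
  proof clarify
    fix \<zeta> and s t :: real assume r: "r = cmod \<zeta>" and "(s, t) \<in> sphere 0 1"
    then have "s\<^sup>2 + t\<^sup>2 = 1" by (simp add: norm_Pair)
    then have "(cmod \<zeta> * s)\<^sup>2 + (cmod \<zeta> * t)\<^sup>2 = (cmod \<zeta>)\<^sup>2"
      by (simp add: power_mult_distrib flip: distrib_left)
    then have "norm (\<zeta> * fst (cplx_pair (s, t)), \<zeta> * snd (cplx_pair (s, t))) = cmod \<zeta>"
      by (simp add: norm_Pair cplx_pair_def norm_mult power_mult_distrib)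
    then show "cmod (f (\<zeta> * fst (cplx_pair (s, t)), \<zeta> * snd (cplx_pair (s, t))))
        \<in> (\<lambda>z. cmod (f z)) ` cball 0 (cmod \<zeta>)"
      by (intro image_eqI[OF refl]) auto
  qed
  ultimately show "bdd_above ?A" by (rule bdd_above_mono)
qed

lemma max_modulus2_le:
  assumes "r \<ge> 0"
    and "\<And>\<zeta> \<theta>. cmod \<zeta> = r \<Longrightarrow> \<theta> \<in> sphere 0 1 \<Longrightarrow>
      cmod (f (\<zeta> * fst (cplx_pair \<theta>), \<zeta> * snd (cplx_pair \<theta>))) \<le> B"
  shows "max_modulus2 f r \<le> B"
  unfolding max_modulus2_def
proof (rule cSup_least)
  have "cmod (of_real r) = r \<and> (1::real, 0::real) \<in> sphere 0 1"
    using assms(1) by (simp add: norm_Pair)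
  then show "{cmod (f (\<zeta> * fst (cplx_pair \<theta>), \<zeta> * snd (cplx_pair \<theta>))) | \<zeta> \<theta>.
            cmod \<zeta> = r \<and> \<theta> \<in> sphere 0 1} \<noteq> {}" by blast
qed (use assms(2) in auto)

text \<open>In the coordinates \<open>x + i y\<close> and \<open>x - i y\<close> the points \<open>\<zeta> \<theta>\<close> with \<open>|\<zeta>| = r\<close> and \<open>\<theta>\<close> on the
  real unit circle fill the torus on which both coordinates have modulus \<open>r\<close>, the distinguished
  boundary of the bidisc below.\<close>

lemma cmod_le_max_modulus2:
  assumes f: "entire2 f" and le: "cmod (x + \<i> * y) \<le> r" "cmod (x - \<i> * y) \<le> r"
  shows "cmod (f (x, y)) \<le> max_modulus2 f r"
proof -
  define F where "F = (\<lambda>u v. f ((u + v) / 2, (u - v) / (2 * \<i>)))"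
  have torus: "cmod (F u v) \<le> max_modulus2 f r" if "cmod u = r" "cmod v = r" for u v
  proof -
    have "u = of_real r * cis (Arg u)" "v = of_real r * cis (Arg v)"
      using that rcis_cmod_Arg[of u] rcis_cmod_Arg[of v] by (simp_all add: rcis_def)
    then obtain \<alpha> \<beta> where u: "u = of_real r * cis \<alpha>" and v: "v = of_real r * cis \<beta>"
      by blast
    \<comment> \<open>The mean of the two arguments goes into \<open>\<zeta>\<close>; half their
      difference is the angle of the real unit vector.\<close>
    define \<zeta> t where "\<zeta> = of_real r * cis ((\<alpha> + \<beta>) / 2)" and "t = (\<alpha> - \<beta>) / 2"
    have "\<alpha> = (\<alpha> + \<beta>) / 2 + t" "\<beta> = (\<alpha> + \<beta>) / 2 + (- t)"
      unfolding t_def by (auto simp: field_simps)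
    then have uv: "u = \<zeta> * cis t" "v = \<zeta> * cis (- t)"
      unfolding u v \<zeta>_def mult.assoc cis_mult by simp_all
    have "u + v = 2 * (\<zeta> * of_real (cos t))" "u - v = (2 * \<i>) * (\<zeta> * of_real (sin t))"
      unfolding uv by (simp_all add: complex_eq_iff algebra_simps)
    then have "(u + v) / 2 = \<zeta> * of_real (cos t)" "(u - v) / (2 * \<i>) = \<zeta> * of_real (sin t)"
      by (simp_all only: nonzero_mult_div_cancel_left) simp_all
    moreover have "cmod \<zeta> = r"
      using that norm_ge_zero[of u] by (simp add: \<zeta>_def norm_mult)
    moreover have "(cos t, sin t) \<in> sphere 0 1" by (simp add: norm_Pair)
    ultimately show ?thesis
      using max_modulus2_ge[OF f, of \<zeta> r "(cos t, sin t)"] by (simp add: F_def cplx_pair_def)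
  qed
  have disc: "cmod (g w) \<le> B"
    if "g holomorphic_on UNIV" "cmod w \<le> r" "\<And>z. cmod z = r \<Longrightarrow> cmod (g z) \<le> B" for g w B
  proof (rule maximum_modulus_frontier[where S = "cball 0 r" and f = g])
    show "g holomorphic_on interior (cball 0 r)" "continuous_on (closure (cball 0 r)) g"
      using that(1) by (auto intro: holomorphic_on_subset continuous_on_subset
          holomorphic_on_imp_continuous_on)
  qed (use that(2,3) in \<open>auto simp: frontier_cball\<close>)
  \<comment> \<open>The maximum principle is applied in one variable at a time: first in
    \<open>v\<close> with \<open>u\<close> on the circle, then in \<open>u\<close> with
    \<open>v\<close> fixed in the disc.\<close>
  have mid: "cmod (F u v) \<le> max_modulus2 f r" if "cmod u = r" "cmod v \<le> r" for u v
    by (rule disc[OF _ that(2) torus[OF that(1)]], unfold F_def,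
        rule entire2_holomorphic_compose[OF f]) (auto intro!: holomorphic_intros)
  have "cmod (F (x + \<i> * y) (x - \<i> * y)) \<le> max_modulus2 f r"
    by (rule disc[of "\<lambda>u. F u (x - \<i> * y)", OF _ le(1) mid[OF _ le(2)]], unfold F_def,
        rule entire2_holomorphic_compose[OF f]) (auto intro!: holomorphic_intros)
  then show ?thesis by (simp add: F_def)
qed

lemma cmod_le_max_modulus2':
  assumes "entire2 f" "cmod x + cmod y \<le> r"
  shows "cmod (f (x, y)) \<le> max_modulus2 f r"
  using assms norm_triangle_ineq[of x "\<i> * y"] norm_triangle_ineq4[of x "\<i> * y"]
  by (intro cmod_le_max_modulus2) (auto simp: norm_mult)

section \<open>Order and bounds by \<open>exp (r powr \<sigma>)\<close>\<close>

text \<open>The threshold 3 exceeds \<open>exp 1\<close>, so the iterated logarithm is nonnegative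
  from there on. By Liouville \<open>f\<close> exceeds 3 in modulus somewhere, and every large
  radius encloses that point.\<close>

lemma eventually_max_modulus2_ge:
  assumes f: "entire2 f" "\<not> f constant_on UNIV"
  shows "eventually (\<lambda>r. max_modulus2 f r \<ge> 3) at_top"
proof -
  obtain x y where xy: "cmod (f (x, y)) > 3"
    using entire2_bounded_imp_constant[OF f(1), of 3] f(2) by (metis not_le surj_pair)
  show ?thesis
    using eventually_ge_at_top[of "cmod x + cmod y"]
  proof eventually_elim
    case (elim r)
    then show ?case using cmod_le_max_modulus2'[OF f(1) elim] xy by simp
  qed
qed

lemma one_le_ln: "1 \<le> ln (x :: real)" if "3 \<le> x"
  using that exp_le by (simp add: ln_ge_iff)

lemma entire_order_nonneg:
  assumes "entire2 f"
  shows "entire_order f \<ge> 0"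
proof (cases "f constant_on UNIV")
  case False
  have "eventually (\<lambda>r. 0 \<le> ereal (ln (ln (max_modulus2 f r)) / ln r)) at_top"
    using eventually_max_modulus2_ge[OF assms False] eventually_gt_at_top[of 1]
    by eventually_elim (use one_le_ln in auto)
  then show ?thesis unfolding entire_order_def using False by (auto intro: le_Limsup)
qed (simp add: entire_order_def)

lemma max_modulus2_le_exp_powr:
  assumes f: "entire2 f" "\<not> f constant_on UNIV" and "entire_order f < ereal \<sigma>"
  shows "eventually (\<lambda>r. max_modulus2 f r \<le> exp (r powr \<sigma>)) at_top"
proof -
  have "Limsup at_top (\<lambda>r::real. ereal (ln (ln (max_modulus2 f r)) / ln r)) < ereal \<sigma>"
    using assms by (simp add: entire_order_def)
  then have "eventually (\<lambda>r. ereal (ln (ln (max_modulus2 f r)) / ln r) < ereal \<sigma>) at_top"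
    by (rule Limsup_lessD)
  then show ?thesis
    using eventually_max_modulus2_ge[OF f] eventually_gt_at_top[of 1]
  proof eventually_elim
    case (elim r)
    let ?M = "max_modulus2 f r"
    have M: "ln ?M \<ge> 1" using elim one_le_ln by blast
    have "ln (ln ?M) \<le> \<sigma> * ln r" using elim by (simp add: field_simps)
    then have "exp (ln (ln ?M)) \<le> exp (\<sigma> * ln r)" by simp
    then have "ln ?M \<le> r powr \<sigma>" using M elim by (simp add: powr_def)
    then have "exp (ln ?M) \<le> exp (r powr \<sigma>)" by simp
    then show ?case using elim by simp
  qed
qed

text \<open>The constant contributes only an additive \<open>ln D\<close> beside
  \<open>r powr \<sigma>\<close>, which disappears in the limit; enlarging \<open>C\<close> to
  \<open>D\<close> makes its logarithm positive.\<close>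

lemma entire_order_le:
  assumes h: "entire2 h" and "0 < \<sigma>"
    and le: "\<And>r. r \<ge> 0 \<Longrightarrow> max_modulus2 h r \<le> C * exp (r powr \<sigma>)"
  shows "entire_order h \<le> ereal \<sigma>"
proof (cases "h constant_on UNIV")
  case False
  define D where "D = \<bar>C\<bar> + 3"
  have D: "D > 0" "ln D > 0" by (auto simp: D_def)
  have lim: "((\<lambda>r. ln (ln D + r powr \<sigma>) / ln r) \<longlongrightarrow> \<sigma>) at_top"
    using D \<open>0 < \<sigma>\<close> by real_asymp
  have "eventually (\<lambda>r. ereal (ln (ln (max_modulus2 h r)) / ln r)
      \<le> ereal (ln (ln D + r powr \<sigma>) / ln r)) at_top"
    using eventually_max_modulus2_ge[OF h False] eventually_gt_at_top[of 1]
  proof eventually_elim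
    case (elim r)
    let ?M = "max_modulus2 h r"
    have "?M \<le> C * exp (r powr \<sigma>)" using elim by (intro le) auto
    also have "\<dots> \<le> D * exp (r powr \<sigma>)" by (intro mult_right_mono) (auto simp: D_def)
    finally have "ln ?M \<le> ln (D * exp (r powr \<sigma>))" using elim by (intro ln_mono) auto
    also have "\<dots> = ln D + r powr \<sigma>" using D by (simp add: ln_mult)
    finally have "ln (ln ?M) \<le> ln (ln D + r powr \<sigma>)"
      using one_le_ln[of ?M] elim by (intro ln_mono) auto
    then show ?case using elim by (simp add: divide_right_mono)
  qed
  then have "Limsup at_top (\<lambda>r::real. ereal (ln (ln (max_modulus2 h r)) / ln r))
      \<le> Limsup at_top (\<lambda>r::real. ereal (ln (ln D + r powr \<sigma>) / ln r))"
    by (rule Limsup_mono)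
  also have "\<dots> = ereal \<sigma>"
    using lim by (intro lim_imp_Limsup tendsto_ereal) auto
  finally show ?thesis using False by (simp add: entire_order_def)
qed (use assms in \<open>simp add: entire_order_def\<close>)

section \<open>Harmonic functions in d'Alembert form\<close>

text \<open>With \<open>\<i>\<close> the square root of \<open>-1\<close>, this is d'Alembert's solution of the wave equation at
  imaginary speed.\<close>

definition dalembert :: "(complex \<Rightarrow> complex) \<Rightarrow> (complex \<Rightarrow> complex) \<Rightarrow> complex \<times> complex \<Rightarrow> complex"
  where "dalembert \<phi> \<psi> z = \<phi> (snd z + \<i> * fst z) + \<psi> (snd z - \<i> * fst z)"

lemma has_field_derivative_compose_affine:
  fixes \<phi> :: "complex \<Rightarrow> complex"
  assumes "\<phi> holomorphic_on UNIV"
  shows "((\<lambda>u. \<phi> (p + q * u)) has_field_derivative q * deriv \<phi> (p + q * w)) (at w)"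
proof -
  have "(\<phi> has_field_derivative deriv \<phi> (p + q * w)) (at (p + q * w))"
    using assms by (auto intro: holomorphic_derivI)
  moreover have "((\<lambda>u. p + q * u) has_field_derivative q) (at w)"
    by (auto intro!: derivative_eq_intros)
  ultimately show ?thesis
    using DERIV_chain2[where f = \<phi> and g = "\<lambda>u. p + q * u"] by (metis mult.commute)
qed

context
  fixes \<phi> \<psi> :: "complex \<Rightarrow> complex"
  assumes \<phi>: "\<phi> holomorphic_on UNIV" and \<psi>: "\<psi> holomorphic_on UNIV"
begin

lemma entire2_dalembert: "entire2 (dalembert \<phi> \<psi>)"
  unfolding entire2_def
proof
  fix z
  have outer: "(\<phi> has_derivative (*) (deriv \<phi> (snd z + \<i> * fst z))) (at (snd z + \<i> * fst z))"
    "(\<psi> has_derivative (*) (deriv \<psi> (snd z - \<i> * fst z))) (at (snd z - \<i> * fst z))"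
    using \<phi> \<psi> by (auto intro: holomorphic_derivI simp flip: has_field_derivative_def)
  have inner: "((\<lambda>z. snd z + \<i> * fst z) has_derivative (\<lambda>v. snd v + \<i> * fst v)) (at z)"
    "((\<lambda>z. snd z - \<i> * fst z) has_derivative (\<lambda>v. snd v - \<i> * fst v)) (at z)"
    by (auto intro!: derivative_eq_intros)
  have "(dalembert \<phi> \<psi> has_derivative
      (\<lambda>v. deriv \<phi> (snd z + \<i> * fst z) * (snd v + \<i> * fst v)
         + deriv \<psi> (snd z - \<i> * fst z) * (snd v - \<i> * fst v))) (at z)"
    unfolding dalembert_def[abs_def]
    by (rule has_derivative_add[OF has_derivative_compose[OF inner(1) outer(1)]
          has_derivative_compose[OF inner(2) outer(2)]])
  then have "(dalembert \<phi> \<psi> has_derivative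
      (\<lambda>v. (\<i> * (deriv \<phi> (snd z + \<i> * fst z) - deriv \<psi> (snd z - \<i> * fst z))) * fst v
         + (deriv \<phi> (snd z + \<i> * fst z) + deriv \<psi> (snd z - \<i> * fst z)) * snd v)) (at z)"
    by (rule has_derivative_eq_rhs) (auto simp: algebra_simps)
  then show "\<exists>a b. (dalembert \<phi> \<psi> has_derivative (\<lambda>v. a * fst v + b * snd v)) (at z)" by blast
qed

text \<open>The result is again in d'Alembert form, so the rule can be iterated for the second
  derivative.\<close>

lemma pderiv1_dalembert:
  "pderiv1 (dalembert \<phi> \<psi>) = dalembert (\<lambda>w. \<i> * deriv \<phi> w) (\<lambda>w. - \<i> * deriv \<psi> w)"
proof
  fix z
  show "pderiv1 (dalembert \<phi> \<psi>) z = dalembert (\<lambda>w. \<i> * deriv \<phi> w) (\<lambda>w. - \<i> * deriv \<psi> w) z"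
    using DERIV_add[OF has_field_derivative_compose_affine[OF \<phi>, of "snd z" \<i> "fst z"]
        has_field_derivative_compose_affine[OF \<psi>, of "snd z" "- \<i>" "fst z"]]
    unfolding pderiv1_def dalembert_def by (intro DERIV_imp_deriv) simp
qed

lemma pderiv2_dalembert: "pderiv2 (dalembert \<phi> \<psi>) = dalembert (deriv \<phi>) (deriv \<psi>)"
proof
  fix z
  show "pderiv2 (dalembert \<phi> \<psi>) z = dalembert (deriv \<phi>) (deriv \<psi>) z"
    using has_field_derivative_compose_affine[OF \<phi>, of "\<i> * fst z" 1 "snd z"]
      has_field_derivative_compose_affine[OF \<psi>, of "- \<i> * fst z" 1 "snd z"]
    unfolding pderiv2_def dalembert_def
    by (intro DERIV_imp_deriv) (auto intro: DERIV_add simp: add.commute)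
qed

end

text \<open>Differentiating twice in the first variable brings out \<open>\<i>\<close> squared or
  \<open>- \<i>\<close> squared, in both cases -1, which cancels the second derivative in the other
  variable.\<close>

lemma harmonic2_dalembert:
  assumes \<phi>: "\<phi> holomorphic_on UNIV" and \<psi>: "\<psi> holomorphic_on UNIV"
  shows "harmonic2 (dalembert \<phi> \<psi>)"
proof -
  have hol: "deriv \<phi> holomorphic_on UNIV" "deriv \<psi> holomorphic_on UNIV"
    using assms by (auto intro: holomorphic_deriv)
  then have hol': "(\<lambda>w. \<i> * deriv \<phi> w) holomorphic_on UNIV"
    "(\<lambda>w. - \<i> * deriv \<psi> w) holomorphic_on UNIV"
    by (auto intro!: holomorphic_intros)
  have scale: "deriv (\<lambda>w. k * deriv \<chi> w) w = k * deriv (deriv \<chi>) w"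
    if "deriv \<chi> holomorphic_on UNIV" for k \<chi> w
    by (rule deriv_cmult[OF holomorphic_on_imp_differentiable_at[OF that open_UNIV UNIV_I]])
  show ?thesis
    unfolding harmonic2_def laplacian2_def pderiv1_dalembert[OF \<phi> \<psi>] pderiv2_dalembert[OF \<phi> \<psi>]
      pderiv1_dalembert[OF hol'] pderiv2_dalembert[OF hol] dalembert_def
      scale[OF hol(1)] scale[OF hol(2)]
    by simp
qed

text \<open>At \<open>\<zeta> \<theta>\<close> the two arguments are \<open>\<zeta>\<close> times
  unimodular numbers, because \<open>\<theta>\<close> is real. The radius is preserved, so bounds on
  \<open>\<phi>\<close> and \<open>\<psi>\<close> carry over at the same \<open>r\<close>.\<close>

lemma max_modulus2_dalembert_le:
  assumes "\<And>w. cmod w = r \<Longrightarrow> cmod (\<phi> w) \<le> A" "\<And>w. cmod w = r \<Longrightarrow> cmod (\<psi> w) \<le> B" "r \<ge> 0"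
  shows "max_modulus2 (dalembert \<phi> \<psi>) r \<le> A + B"
proof (rule max_modulus2_le[OF assms(3)])
  fix \<zeta> :: complex and \<theta> :: "real \<times> real"
  assume \<zeta>: "cmod \<zeta> = r" and "\<theta> \<in> sphere 0 1"
  then have "(fst \<theta>)\<^sup>2 + (snd \<theta>)\<^sup>2 = 1" by (cases \<theta>) (simp add: norm_Pair)
  then have "cmod (Complex (snd \<theta>) (fst \<theta>)) = 1" "cmod (Complex (snd \<theta>) (- fst \<theta>)) = 1"
    by (simp_all add: cmod_def add.commute)
  then have "cmod (\<zeta> * Complex (snd \<theta>) (fst \<theta>)) = r" "cmod (\<zeta> * Complex (snd \<theta>) (- fst \<theta>)) = r"
    using \<zeta> by (simp_all add: norm_mult)
  moreover have "Complex (snd \<theta>) (fst \<theta>) = of_real (snd \<theta>) + \<i> * of_real (fst \<theta>)"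
    "Complex (snd \<theta>) (- fst \<theta>) = of_real (snd \<theta>) - \<i> * of_real (fst \<theta>)"
    by (simp_all add: complex_eq_iff)
  ultimately have "cmod (\<zeta> * snd (cplx_pair \<theta>) + \<i> * (\<zeta> * fst (cplx_pair \<theta>))) = r"
    "cmod (\<zeta> * snd (cplx_pair \<theta>) - \<i> * (\<zeta> * fst (cplx_pair \<theta>))) = r"
    by (simp_all add: cplx_pair_def algebra_simps)
  then show "cmod (dalembert \<phi> \<psi> (\<zeta> * fst (cplx_pair \<theta>), \<zeta> * snd (cplx_pair \<theta>))) \<le> A + B"
    unfolding dalembert_def fst_conv snd_conv
    by (intro order.trans[OF norm_triangle_ineq] add_mono assms)
qed

section \<open>Harmonic interpolation on the two lines\<close>

theorem theorem5:
  fixes f :: "complex \<times> complex \<Rightarrow> complex" and a :: real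
  assumes "entire2 f" and "entire_order f < 1" and "a > 0"
  shows "\<exists>h. entire2 h \<and> harmonic2 h \<and> entire_order h \<le> entire_order f \<and>
           (\<forall>x \<in> {(x1, x2). x1\<^sup>2 = a\<^sup>2}. h (cplx_pair x) = f (cplx_pair x))"
proof (cases "f constant_on UNIV")
  case True
  then obtain k where k: "f = (\<lambda>_. k)" unfolding constant_on_def fun_eq_iff by blast
  then have "harmonic2 f"
    by (simp add: harmonic2_def laplacian2_def pderiv1_def[abs_def] pderiv2_def[abs_def])
  then show ?thesis using assms(1) by blast
next
  case False
  obtain \<rho> where \<rho>: "entire_order f = ereal \<rho>" "0 \<le> \<rho>" "\<rho> < 1"
    using entire_order_nonneg[OF assms(1)] assms(2) by (cases "entire_order f") auto
  define g where "g = (\<lambda>s y. f (of_real s, y))"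
  have g_hol: "(\<lambda>y. g s (p y)) holomorphic_on UNIV" if "p holomorphic_on UNIV" for s p
    unfolding g_def by (rule entire2_holomorphic_compose[OF assms(1)]) (use that in auto)
  have g_order: "order_type_le \<rho> (g s)" for s
    unfolding order_type_le_def
  proof (intro allI impI)
    fix \<sigma> assume \<sigma>: "\<rho> < \<sigma>" "\<sigma> < 1"
    have "eventually (\<lambda>r. max_modulus2 f r \<le> exp (r powr \<sigma>)) at_top"
      using \<rho> \<sigma> by (intro max_modulus2_le_exp_powr assms(1) False) simp
    then obtain R where R: "\<And>r. r \<ge> R \<Longrightarrow> max_modulus2 f r \<le> exp (r powr \<sigma>)"
      unfolding eventually_at_top_linorder by blast
    \<comment> \<open>The part \<open>\<bar>s\<bar>\<close> makes the radius
      \<open>t + cmod y\<close> cover the point \<open>(s, y)\<close>; the part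
      \<open>\<bar>R\<bar>\<close> takes it past \<open>R\<close> for every
      \<open>y\<close>.\<close>
    define t where "t = \<bar>s\<bar> + \<bar>R\<bar>"
    have "cmod (g s y) \<le> exp (t powr \<sigma>) * exp (cmod y powr \<sigma>)" for y
    proof -
      have "cmod (g s y) \<le> max_modulus2 f (t + cmod y)"
        unfolding g_def t_def by (rule cmod_le_max_modulus2'[OF assms(1)]) simp
      also have "\<dots> \<le> exp ((t + cmod y) powr \<sigma>)"
        by (rule R) (use norm_ge_zero[of y] in \<open>unfold t_def, linarith\<close>)
      also have "\<dots> \<le> exp (t powr \<sigma> + cmod y powr \<sigma>)"
        unfolding exp_le_cancel_iff by (rule powr_add_le) (use \<rho> \<sigma> in \<open>auto simp: t_def\<close>)
      finally show ?thesis by (simp add: exp_add)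
    qed
    then show "\<exists>C. \<forall>z. cmod (g s z) \<le> C * exp (cmod z powr \<sigma>)" by blast
  qed
  \<comment> \<open>On the line \<open>x = a\<close> the arguments \<open>y + \<i> x\<close> and
    \<open>y - \<i> x\<close> are \<open>y + b\<close> and \<open>y - b\<close>; on
    \<open>x = - a\<close> they are interchanged.\<close>
  define b where "b = \<i> * of_real a"
  have "b \<noteq> 0" using assms(3) by (simp add: b_def)
  obtain \<phi> where \<phi>: "\<phi> holomorphic_on UNIV" "order_type_le \<rho> \<phi>"
    "\<And>z. \<phi> (z + 4 * b) - \<phi> z = g a (z + 3 * b) - g (- a) (z + b)"
  proof (rule difference_equation)
    show "(\<lambda>z. g a (z + 3 * b) - g (- a) (z + b)) holomorphic_on UNIV"
      by (intro holomorphic_intros g_hol)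
    show "order_type_le \<rho> (\<lambda>z. g a (z + 3 * b) - g (- a) (z + b))"
      by (intro order_type_le_diff order_type_le_shift g_order \<rho>)
    show "4 * b \<noteq> 0" using \<open>b \<noteq> 0\<close> by simp
  qed (use \<rho> in auto)
  define \<psi> where "\<psi> = (\<lambda>z. g a (z + b) - \<phi> (z + 2 * b))"
  have "(\<lambda>z. z + 2 * b) holomorphic_on UNIV" by (intro holomorphic_intros)
  from holomorphic_on_compose_gen[OF this \<phi>(1)]
  have "(\<lambda>z. \<phi> (z + 2 * b)) holomorphic_on UNIV" by (simp add: comp_def)
  then have \<psi>_hol: "\<psi> holomorphic_on UNIV"
    unfolding \<psi>_def by (intro holomorphic_on_diff g_hol holomorphic_intros)
  have \<psi>_order: "order_type_le \<rho> \<psi>"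
    unfolding \<psi>_def by (intro order_type_le_diff order_type_le_shift g_order \<phi> \<rho>)
  define h where "h = dalembert \<phi> \<psi>"
  have h: "entire2 h" "harmonic2 h"
    unfolding h_def by (intro entire2_dalembert harmonic2_dalembert \<phi> \<psi>_hol)+
  have order_h: "entire_order h \<le> ereal \<sigma>" if \<sigma>: "\<rho> < \<sigma>" "\<sigma> < 1" for \<sigma>
  proof -
    obtain C D where "\<And>z. cmod (\<phi> z) \<le> C * exp (cmod z powr \<sigma>)"
      "\<And>z. cmod (\<psi> z) \<le> D * exp (cmod z powr \<sigma>)"
      using order_type_leE[OF \<phi>(2) \<sigma>] order_type_leE[OF \<psi>_order \<sigma>] by metis
    then have "max_modulus2 h r \<le> C * exp (r powr \<sigma>) + D * exp (r powr \<sigma>)" if "r \<ge> 0" for r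
      unfolding h_def by (intro max_modulus2_dalembert_le that) auto
    then show ?thesis
      using \<rho> \<sigma> by (intro entire_order_le[OF h(1), of _ "C + D"]) (auto simp: distrib_right)
  qed
  have "entire_order h \<le> ereal \<rho>"
  proof (rule ereal_le_epsilon2)
    fix e :: real assume "e > 0"
    \<comment> \<open>The midpoint of \<open>\<rho>\<close> and 1 keeps the exponent below 1 when
      \<open>e\<close> is large.\<close>
    have "entire_order h \<le> ereal (min (\<rho> + e) ((\<rho> + 1) / 2))"
      by (rule order_h) (use \<rho> \<open>e > 0\<close> in \<open>auto simp: min_less_iff_disj\<close>)
    also have "\<dots> \<le> ereal \<rho> + ereal e" by simp
    finally show "entire_order h \<le> ereal \<rho> + ereal e" .
  qed
  moreover have "h (cplx_pair x) = f (cplx_pair x)" if "x \<in> {(x1, x2). x1\<^sup>2 = a\<^sup>2}" for x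
  proof -
    obtain x1 x2 where x: "x = (x1, x2)" "x1\<^sup>2 = a\<^sup>2" using \<open>x \<in> _\<close> by auto
    define y where "y = complex_of_real x2"
    \<comment> \<open>The line \<open>x = a\<close> is matched by the choice of
      \<open>\<psi>\<close> alone; the line \<open>x = - a\<close> takes the difference equation at
      \<open>y - b\<close>.\<close>
    have "\<phi> (y + b) + \<psi> (y - b) = g a y" by (simp add: \<psi>_def add.commute)
    moreover have "\<phi> (y - b) + \<psi> (y + b) = g (- a) y"
      using \<phi>(3)[of "y - b"] by (simp add: \<psi>_def algebra_simps)
    moreover have "x1 = a \<or> x1 = - a" using x(2) power2_eq_iff by blast
    ultimately show ?thesis
      by (elim disjE) (simp_all add: x h_def dalembert_def cplx_pair_def g_def b_def y_def)
  qed
  ultimately show ?thesis using h \<rho>(1) by auto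
qed

end
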